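(* Let $X$ be a complex vector space with a norm $\|\cdot\|$, and let $\langle \cdot \mid \cdot\rangle : X\times X\to\mathbb{C}$ be the product associated with $\|\cdot\|$ as defined in the context. Then for all $\vec{x},\vec{y}\in X$, $$|\langle \vec{x}\mid\vec{y}\rangle| \le \|\vec{x}\|\cdot\|\vec{y}\|.$$
   Context: For a complex normed vector space $(X,\|\cdot\|)$, with $\mathbf{i}$ the imaginary unit, the associated product $\langle\cdot\mid\cdot\rangle: X\times X\to\mathbb{C}$ is defined as follows. If $\vec{x}=\vec{0}$ or $\vec{y}=\vec{0}$, set $\langle\vec{x}\mid\vec{y}\rangle:=0$. If $\vec{x},\vec{y}\neq\vec{0}$, set $$\langle\vec{x}\mid\vec{y}\rangle := \|\vec{x}\|\,\|\vec{y}\|\cdot\frac14\left[\left\|\frac{\vec{x}}{\|\vec{x}\|}+\frac{\vec{y}}{\|\vec{y}\|}\right\|^2-\left\|\frac{\vec{x}}{\|\vec{x}\|}-\frac{\vec{y}}{\|\vec{y}\|}\right\|^2+\mathbf{i}\left(\left\|\frac{\vec{x}}{\|\vec{x}\|}+\mathbf{i}\frac{\vec{y}}{\|\vec{y}\|}\right\|^2-\left\|\frac{\vec{x}}{\|\vec{x}\|}-\mathbf{i}\frac{\vec{y}}{\|\vec{y}\|}\right\|^2\right)\right].$$ The norm is not assumed to come from an inner product. *)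

theory Defs
  imports Complex_Main
begin

text \<open>
  Scalar multiplication and norm are explicit parameters, since the distribution has no type
  class of complex normed vector spaces. Nonnegativity of the norm follows from the axioms.
\<close>

locale complex_normed_space = vector_space scale
  for scale :: "complex \<Rightarrow> 'a::ab_group_add \<Rightarrow> 'a" +
  fixes nrm :: "'a \<Rightarrow> real"
  assumes nrm_eq_0_iff: "nrm x = 0 \<longleftrightarrow> x = 0"
    and nrm_triangle: "nrm (x + y) \<le> nrm x + nrm y"
    and nrm_scale: "nrm (scale c x) = cmod c * nrm x"

definition unit_vec :: "(complex \<Rightarrow> 'a \<Rightarrow> 'a) \<Rightarrow> ('a \<Rightarrow> real) \<Rightarrow> 'a \<Rightarrow> 'a" where
  "unit_vec scale nrm x = scale (complex_of_real (1 / nrm x)) x"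

definition assoc_product ::
  "(complex \<Rightarrow> 'a \<Rightarrow> 'a) \<Rightarrow> ('a \<Rightarrow> real) \<Rightarrow> 'a \<Rightarrow> 'a::ab_group_add \<Rightarrow> complex" where
  "assoc_product scale nrm x y =
     (if x = 0 \<or> y = 0 then 0
      else
        (let u = unit_vec scale nrm x; v = unit_vec scale nrm y
         in complex_of_real (nrm x * nrm y) * (1 / 4) *
              (complex_of_real ((nrm (u + v))\<^sup>2 - (nrm (u - v))\<^sup>2)
               + \<i> * complex_of_real ((nrm (u + scale \<i> v))\<^sup>2 - (nrm (u - scale \<i> v))\<^sup>2))))"

end

theory Submission
  imports Defs "HOL-Analysis.Convex_Euclidean_Space"
begin

text \<open>
  By homogeneity the claim concerns two unit vectors \<open>u\<close>, \<open>v\<close>: the four numbers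
  \<open>a = nrm (u + v)\<close>, \<open>b = nrm (u - v)\<close>, \<open>c = nrm (u + \<i>v)\<close>, \<open>d = nrm (u - \<i>v)\<close> must satisfy
  \<open>(a\<^sup>2 - b\<^sup>2)\<^sup>2 + (c\<^sup>2 - d\<^sup>2)\<^sup>2 \<le> 16\<close>.  Multiplying \<open>v\<close> by \<open>-1\<close> exchanges \<open>a\<close> with \<open>b\<close> and \<open>c\<close> with \<open>d\<close>,
  and exchanging \<open>u\<close> with \<open>v\<close> exchanges only \<open>c\<close> with \<open>d\<close>; so one may assume \<open>b \<le> a\<close> and \<open>d \<le> c\<close>.

  Now the large numbers \<open>a\<close> and \<open>c\<close> are attained by linear functionals of norm at most one on the
  span of \<open>u\<close> and \<open>v\<close> (lemma \<open>norming_functional\<close>), while every such functional bounds the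
  small numbers \<open>b\<close> and \<open>d\<close> from below.  Let the first functional take the values \<open>p\<close>, \<open>p'\<close> and
  the second one the values \<open>q\<close>, \<open>q'\<close> on \<open>u\<close>, \<open>v\<close>.  The idea is to use the functional of \<open>a\<close> against \<open>d\<close>
  and that of \<open>c\<close> against \<open>b\<close>:
  \<open>a\<^sup>2 - b\<^sup>2 \<le> \<bar>p + p'\<bar>\<^sup>2 - \<bar>q - q'\<bar>\<^sup>2\<close> and \<open>c\<^sup>2 - d\<^sup>2 \<le> \<bar>q + \<i>q'\<bar>\<^sup>2 - \<bar>p - \<i>p'\<bar>\<^sup>2\<close>.
  With \<open>P = p \<cdot> cnj p'\<close>, \<open>Q = q \<cdot> cnj q'\<close> the right-hand sides are \<open>2 Re (P + Q) + 2\<delta>\<close> and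
  \<open>2 Im (P + Q) - 2\<delta>\<close>, where \<open>2\<delta> = (\<bar>p\<bar>\<^sup>2 + \<bar>p'\<bar>\<^sup>2) - (\<bar>q\<bar>\<^sup>2 + \<bar>q'\<bar>\<^sup>2)\<close>.  If \<open>\<delta> = 0\<close>, they are the coordinates of
  twice the sum of two points of the unit disc, a vector of length at most 4.  The defect \<open>\<delta>\<close> is
  harmless: if it is positive, then the arithmetic-geometric mean inequality gives
  \<open>\<bar>Q\<bar> \<le> (\<bar>q\<bar>\<^sup>2 + \<bar>q'\<bar>\<^sup>2) / 2 \<le> 1 - \<delta>\<close>, which leaves room for the shift (lemma \<open>shifted_disc_bound\<close>);
  if it is negative, the same holds for \<open>P\<close>.
\<close>

section \<open>Norming functionals on the span of two vectors\<close>

context complex_normed_space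
begin

lemma nrm_zero [simp]: "nrm 0 = 0"
  by (simp add: nrm_eq_0_iff)

lemma nrm_uminus: "nrm (- x) = nrm x"
  using nrm_scale[of "-1" x] by simp

lemma nrm_minus_commute: "nrm (x - y) = nrm (y - x)"
  using nrm_uminus[of "x - y"] by simp

lemma nrm_nonneg: "0 \<le> nrm x"
  using nrm_triangle[of x "- x"] by (simp add: nrm_uminus)

text \<open>
  A two-dimensional instance of the Hahn-Banach theorem.  The map \<open>N\<close> sending \<open>(w, z)\<close> to
  the norm of \<open>wu + zv\<close> is a seminorm on \<open>\<complex>\<^sup>2\<close>, which is a finite-dimensional real Euclidean space; hence
  the real part of the functional is obtained by separating the given point from the convex set of all
  points of smaller seminorm.
\<close>

lemma norming_functional:
  fixes u v :: 'a and w0 z0 :: complex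
  obtains p p' where
    "\<And>w z. cmod (p * w + p' * z) \<le> nrm (scale w u + scale z v)"
    "cmod (p * w0 + p' * z0) = nrm (scale w0 u + scale z0 v)"
proof -
  define N where "N = (\<lambda>x :: complex \<times> complex. nrm (scale (fst x) u + scale (snd x) v))"
  define x0 where "x0 = (w0, z0)"
  have N_nonneg: "0 \<le> N x" for x
    by (simp add: N_def nrm_nonneg)
  have N_add: "N (x + y) \<le> N x + N y" for x y
  proof -
    have "scale (fst (x + y)) u + scale (snd (x + y)) v
        = (scale (fst x) u + scale (snd x) v) + (scale (fst y) u + scale (snd y) v)"
      by (simp add: scale_left_distrib algebra_simps)
    then show ?thesis
      unfolding N_def by (metis nrm_triangle)
  qed
  have N_mult: "N (c * w, c * z) = cmod c * N (w, z)" for c w z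
    unfolding N_def
    by (simp flip: nrm_scale scale_scale add: scale_right_distrib)
  have N_scaleR: "N (r *\<^sub>R x) = \<bar>r\<bar> * N x" for r x
    using N_mult[of "of_real r" "fst x" "snd x"] by (simp add: scaleR_prod_def scaleR_conv_of_real)
  have N_zero: "N 0 = 0"
    by (simp add: N_def)
  show ?thesis
  proof (cases "N x0 = 0")
    case True
    then show ?thesis
      by (intro that[of 0 0]) (auto simp: N_def x0_def nrm_nonneg)
  next
    case False
    define a where "a = N x0"
    have a: "0 < a"
      using False N_nonneg[of x0] by (simp add: a_def)
    have "convex {x. N x < a}"
    proof (rule convexI)
      fix x y :: "complex \<times> complex" and r s :: real
      assume xy: "x \<in> {x. N x < a}" "y \<in> {x. N x < a}" and rs: "0 \<le> r" "0 \<le> s" "r + s = 1"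
      have "N (r *\<^sub>R x + s *\<^sub>R y) \<le> r * N x + s * N y"
        using N_add[of "r *\<^sub>R x" "s *\<^sub>R y"] rs by (simp add: N_scaleR)
      also have "\<dots> < a"
        using xy rs by (intro convex_bound_lt) auto
      finally show "r *\<^sub>R x + s *\<^sub>R y \<in> {x. N x < a}"
        by simp
    qed
    moreover have "{x. N x < a} \<noteq> {}"
      using a N_zero by (metis (mono_tags, lifting) empty_iff mem_Collect_eq)
    moreover have "{x. N x < a} \<inter> {x0} = {}"
      by (simp add: a_def)
    ultimately have "\<exists>g e. g \<noteq> 0 \<and> (\<forall>x\<in>{x. N x < a}. g \<bullet> x \<le> e) \<and> (\<forall>x\<in>{x0}. e \<le> g \<bullet> x)"
      by (intro separating_hyperplane_sets) simp_all
    then obtain g e where g: "g \<noteq> 0"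
        and ge: "\<And>x. N x < a \<Longrightarrow> g \<bullet> x \<le> e" and ge0: "e \<le> g \<bullet> x0"
      by blast
    have below: "g \<bullet> x \<le> g \<bullet> x0" if "N x < a" for x
      using ge[OF that] ge0 by linarith
    have scaled: "g \<bullet> x * a \<le> (g \<bullet> x0) * N x" for x
    proof (rule field_le_epsilon)
      fix \<epsilon> :: real assume \<epsilon>: "0 < \<epsilon>"
      have pos: "0 \<le> g \<bullet> x0"
        using below[of 0] a by (simp add: N_zero)
      define \<eta> where "\<eta> = \<epsilon> / (1 + g \<bullet> x0)"
      have \<eta>: "0 < \<eta>" "(g \<bullet> x0) * \<eta> \<le> \<epsilon>"
        using \<epsilon> pos by (auto simp: \<eta>_def field_simps)
      have D: "0 < N x + \<eta>"
        using N_nonneg[of x] \<eta> by linarith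
      have "N ((a / (N x + \<eta>)) *\<^sub>R x) < a"
        using D a \<eta> N_nonneg[of x] by (simp add: N_scaleR field_simps)
      from below[OF this] have "g \<bullet> x * a \<le> (g \<bullet> x0) * (N x + \<eta>)"
        using D by (simp add: field_simps)
      also have "\<dots> \<le> (g \<bullet> x0) * N x + \<epsilon>"
        using \<eta> by (simp add: distrib_left)
      finally show "g \<bullet> x * a \<le> (g \<bullet> x0) * N x + \<epsilon>" .
    qed
    have "0 < g \<bullet> x0"
    proof -
      have "0 < (g \<bullet> g) * a"
        using g a by simp
      also have "\<dots> \<le> (g \<bullet> x0) * N g"
        by (rule scaled)
      finally show ?thesis
        using N_nonneg[of g] by (simp add: zero_less_mult_iff)
    qed
    define k where "k = a / (g \<bullet> x0)"
    define \<phi> where "\<phi> = (\<lambda>w z. of_real k * cnj (fst g) * w + of_real k * cnj (snd g) * z)"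
    have Re_\<phi>: "Re (\<phi> w z) = k * (g \<bullet> (w, z))" for w z
      by (simp add: \<phi>_def inner_prod_def inner_complex_def algebra_simps)
    have Re_le: "Re (\<phi> w z) \<le> N (w, z)" for w z
      using scaled[of "(w, z)"] \<open>0 < g \<bullet> x0\<close> by (simp add: Re_\<phi> k_def field_simps)
    \<comment> \<open>Rotating the argument so that the value of the functional becomes real and nonnegative
      turns the bound on its real part into one on its modulus.\<close>
    have le: "cmod (\<phi> w z) \<le> N (w, z)" for w z
    proof -
      define c where "c = cnj (sgn (\<phi> w z))"
      have c: "cmod c \<le> 1"
        by (simp add: c_def norm_sgn)
      have "\<phi> (c * w) (c * z) = c * \<phi> w z"
        by (simp add: \<phi>_def algebra_simps)
      also have "\<dots> = of_real (cmod (\<phi> w z))"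
      proof (cases "\<phi> w z = 0")
        case False
        have "cnj (\<phi> w z) * \<phi> w z = of_real (cmod (\<phi> w z)) * of_real (cmod (\<phi> w z))"
          using complex_norm_square[of "\<phi> w z"] by (simp add: power2_eq_square mult.commute)
        with False show ?thesis
          by (simp add: c_def sgn_eq)
      qed simp
      finally have "cmod (\<phi> w z) = Re (\<phi> (c * w) (c * z))"
        by simp
      also have "\<dots> \<le> cmod c * N (w, z)"
        using Re_le[of "c * w" "c * z"] by (simp add: N_mult)
      also have "\<dots> \<le> N (w, z)"
        using mult_right_mono[OF c N_nonneg[of "(w, z)"]] by simp
      finally show ?thesis .
    qed
    have "Re (\<phi> w0 z0) = a"
      using \<open>0 < g \<bullet> x0\<close> by (simp add: Re_\<phi> k_def flip: x0_def)
    then have "N (w0, z0) \<le> cmod (\<phi> w0 z0)"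
      using complex_Re_le_cmod[of "\<phi> w0 z0"] by (simp add: a_def x0_def)
    with le[of w0 z0] have "cmod (\<phi> w0 z0) = N (w0, z0)"
      by linarith
    with le show ?thesis
      by (intro that[of "of_real k * cnj (fst g)" "of_real k * cnj (snd g)"])
        (simp_all add: \<phi>_def N_def)
  qed
qed

end

section \<open>Planar estimates\<close>

lemma Re_mult_cnj_parallelogram:
  "(cmod (p + q))\<^sup>2 = (cmod p)\<^sup>2 + (cmod q)\<^sup>2 + 2 * Re (p * cnj q)"
  "(cmod (p - q))\<^sup>2 = (cmod p)\<^sup>2 + (cmod q)\<^sup>2 - 2 * Re (p * cnj q)"
  unfolding cmod_power2 by (simp_all add: power2_eq_square algebra_simps)

lemma Im_mult_cnj_parallelogram:
  "(cmod (p + \<i> * q))\<^sup>2 = (cmod p)\<^sup>2 + (cmod q)\<^sup>2 + 2 * Im (p * cnj q)"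
  "(cmod (p - \<i> * q))\<^sup>2 = (cmod p)\<^sup>2 + (cmod q)\<^sup>2 - 2 * Im (p * cnj q)"
  unfolding cmod_power2 by (simp_all add: power2_eq_square algebra_simps)

lemma cmod_mult_cnj_le: "cmod (p * cnj q) \<le> ((cmod p)\<^sup>2 + (cmod q)\<^sup>2) / 2"
  using sum_squares_bound[of "cmod p" "cmod q"] by (simp add: norm_mult)

lemma Complex_mono:
  assumes "\<bar>x\<bar> \<le> \<bar>x'\<bar>" "\<bar>y\<bar> \<le> \<bar>y'\<bar>"
  shows "cmod (Complex x y) \<le> cmod (Complex x' y')"
  using assms by (auto simp: cmod_def abs_le_square_iff intro!: real_sqrt_le_mono add_mono)

text \<open>
  Moving the second point by \<open>\<delta>\<close> to the right costs at most the length \<open>\<delta>\<close> by which it falls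
  short of \<open>m\<close>.  Moving it down by \<open>\<delta>\<close> as well costs nothing as long as one stops at the real axis,
  and stopping there is legitimate because it only weakens the upper bound for \<open>t\<close>.  As \<open>s\<close> and \<open>t\<close> are
  nonnegative, coordinatewise upper bounds do bound the length of \<open>(s, t)\<close>.
\<close>

lemma shifted_disc_bound:
  fixes s t \<delta> m x\<^sub>1 y\<^sub>1 x\<^sub>2 y\<^sub>2 :: real
  assumes "0 \<le> s" "0 \<le> t" "0 \<le> \<delta>"
    and P: "cmod (Complex x\<^sub>1 y\<^sub>1) \<le> m"
    and Q: "cmod (Complex x\<^sub>2 y\<^sub>2) + \<delta> \<le> m"
    and s: "2 * s \<le> x\<^sub>1 + x\<^sub>2 + \<delta>" and t: "2 * t \<le> y\<^sub>1 + y\<^sub>2 - \<delta>"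
  shows "cmod (Complex s t) \<le> m"
proof -
  define y where "y = max 0 (y\<^sub>2 - \<delta>)"
  have "cmod (Complex (x\<^sub>2 + \<delta>) y) \<le> cmod (Complex (x\<^sub>2 + \<delta>) y\<^sub>2)"
    using \<open>0 \<le> \<delta>\<close> by (intro Complex_mono) (auto simp: y_def)
  also have "\<dots> \<le> cmod (Complex x\<^sub>2 y\<^sub>2) + \<delta>"
    using norm_triangle_ineq[of "Complex x\<^sub>2 y\<^sub>2" "complex_of_real \<delta>"] \<open>0 \<le> \<delta>\<close>
    by (simp add: Complex_eq algebra_simps)
  finally have Q': "cmod (Complex (x\<^sub>2 + \<delta>) y) \<le> m"
    using Q by linarith
  have "2 * cmod (Complex s t) = cmod (Complex (2 * s) (2 * t))"
    using norm_scaleR[of 2 "Complex s t"] by (simp add: scaleR_complex.code)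
  also have "\<dots> \<le> cmod (Complex (x\<^sub>1 + (x\<^sub>2 + \<delta>)) (y\<^sub>1 + y))"
    using assms by (intro Complex_mono) (auto simp: y_def)
  also have "\<dots> \<le> cmod (Complex x\<^sub>1 y\<^sub>1) + cmod (Complex (x\<^sub>2 + \<delta>) y)"
    using norm_triangle_ineq[of "Complex x\<^sub>1 y\<^sub>1" "Complex (x\<^sub>2 + \<delta>) y"]
    by (simp add: plus_complex.code)
  finally show ?thesis
    using P Q' by linarith
qed

text \<open>
  The functional with the smaller sum of squares plays the part of the second point in
  \<open>shifted_disc_bound\<close>.  When this is \<open>(p, p')\<close>, the defect shifts upwards instead of to the right, so
  real and imaginary parts are exchanged, which leaves the modulus unchanged.
\<close>

lemma crossed_functionals_bound:
  fixes p p' q q' :: complex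
  assumes unit: "cmod p \<le> 1" "cmod p' \<le> 1" "cmod q \<le> 1" "cmod q' \<le> 1"
    and "0 \<le> s" "0 \<le> t"
    and s: "4 * s \<le> (cmod (p + p'))\<^sup>2 - (cmod (q - q'))\<^sup>2"
    and t: "4 * t \<le> (cmod (q + \<i> * q'))\<^sup>2 - (cmod (p - \<i> * p'))\<^sup>2"
  shows "cmod (Complex s t) \<le> 1"
proof -
  define P where "P = p * cnj p'"
  define Q where "Q = q * cnj q'"
  define m where "m = ((cmod p)\<^sup>2 + (cmod p')\<^sup>2) / 2"
  define n where "n = ((cmod q)\<^sup>2 + (cmod q')\<^sup>2) / 2"
  have "(cmod p)\<^sup>2 \<le> 1" "(cmod p')\<^sup>2 \<le> 1" "(cmod q)\<^sup>2 \<le> 1" "(cmod q')\<^sup>2 \<le> 1"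
    using unit by (simp_all add: abs_square_le_1)
  then have mn: "m \<le> 1" "n \<le> 1"
    by (simp_all add: m_def n_def)
  have PQ: "cmod (Complex (Re P) (Im P)) \<le> m" "cmod (Complex (Re Q) (Im Q)) \<le> n"
    unfolding complex_surj P_def Q_def m_def n_def by (rule cmod_mult_cnj_le)+
  have st: "2 * s \<le> Re P + Re Q + (m - n)" "2 * t \<le> Im P + Im Q - (m - n)"
    using s t unfolding Im_mult_cnj_parallelogram unfolding Re_mult_cnj_parallelogram
    by (simp_all add: P_def Q_def m_def n_def field_simps)
  have swap: "cmod (Complex y x) = cmod (Complex x y)" for x y
    by (simp add: cmod_def add.commute)
  show ?thesis
  proof (cases "n \<le> m")
    case True
    have "cmod (Complex s t) \<le> m"
      using True PQ st \<open>0 \<le> s\<close> \<open>0 \<le> t\<close>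
      by (intro shifted_disc_bound[of s t "m - n" "Re P" "Im P" m "Re Q" "Im Q"]) simp_all
    with mn show ?thesis by linarith
  next
    case False
    have "cmod (Complex t s) \<le> n"
      using False PQ st \<open>0 \<le> s\<close> \<open>0 \<le> t\<close>
      by (intro shifted_disc_bound[of t s "n - m" "Im Q" "Re Q" n "Im P" "Re P"])
        (simp_all add: swap[of "Im P"] swap[of "Im Q"])
    with mn show ?thesis by (simp add: swap)
  qed
qed

section \<open>The product of two unit vectors\<close>

context complex_normed_space
begin

lemma unit_product_bound_nonneg:
  assumes uv: "nrm u = 1" "nrm v = 1"
    and re: "nrm (u - v) \<le> nrm (u + v)" and im: "nrm (u - scale \<i> v) \<le> nrm (u + scale \<i> v)"
  shows "cmod (Complex ((nrm (u + v))\<^sup>2 - (nrm (u - v))\<^sup>2)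
           ((nrm (u + scale \<i> v))\<^sup>2 - (nrm (u - scale \<i> v))\<^sup>2)) \<le> 4" (is "cmod (Complex ?s ?t) \<le> 4")
proof -
  obtain p p' where p: "\<And>w z. cmod (p * w + p' * z) \<le> nrm (scale w u + scale z v)"
      and a: "cmod (p * 1 + p' * 1) = nrm (scale 1 u + scale 1 v)"
    using norming_functional[of u v 1 1] by metis
  obtain q q' where q: "\<And>w z. cmod (q * w + q' * z) \<le> nrm (scale w u + scale z v)"
      and c: "cmod (q * 1 + q' * \<i>) = nrm (scale 1 u + scale \<i> v)"
    using norming_functional[of u v 1 \<i>] by metis
  have unit: "cmod p \<le> 1" "cmod p' \<le> 1" "cmod q \<le> 1" "cmod q' \<le> 1"
    using p[of 1 0] p[of 0 1] q[of 1 0] q[of 0 1] uv by simp_all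
  have "cmod (q - q') \<le> nrm (u - v)"
    using q[of 1 "-1"] by simp
  then have b: "(cmod (q - q'))\<^sup>2 \<le> (nrm (u - v))\<^sup>2"
    by (intro power_mono) simp_all
  have "cmod (p - \<i> * p') \<le> nrm (u - scale \<i> v)"
    using p[of 1 "- \<i>"] by (simp add: mult.commute)
  then have d: "(cmod (p - \<i> * p'))\<^sup>2 \<le> (nrm (u - scale \<i> v))\<^sup>2"
    by (intro power_mono) simp_all
  have "cmod (Complex (?s / 4) (?t / 4)) \<le> 1"
  proof (rule crossed_functionals_bound[OF unit])
    show "0 \<le> ?s / 4" "0 \<le> ?t / 4"
      using re im by (simp_all add: nrm_nonneg power_mono)
    show "4 * (?s / 4) \<le> (cmod (p + p'))\<^sup>2 - (cmod (q - q'))\<^sup>2"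
      using a b by simp
    show "4 * (?t / 4) \<le> (cmod (q + \<i> * q'))\<^sup>2 - (cmod (p - \<i> * p'))\<^sup>2"
      using c d by (simp add: mult.commute)
  qed
  moreover have "Complex ?s ?t = 4 *\<^sub>R Complex (?s / 4) (?t / 4)"
    by (simp add: complex_eq_iff)
  ultimately show ?thesis
    by (metis abs_numeral mult.right_neutral mult_left_mono norm_scaleR zero_le_numeral)
qed

lemma nrm_swap_i:
  "nrm (v + scale \<i> u) = nrm (u - scale \<i> v)" "nrm (v - scale \<i> u) = nrm (u + scale \<i> v)"
proof -
  have "v + scale \<i> u = scale \<i> (u - scale \<i> v)"
    by (simp add: scale_right_diff_distrib add.commute)
  then show "nrm (v + scale \<i> u) = nrm (u - scale \<i> v)"
    by (simp add: nrm_scale)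
  have "v - scale \<i> u = scale (- \<i>) (u + scale \<i> v)"
    by (simp add: scale_right_distrib)
  then show "nrm (v - scale \<i> u) = nrm (u + scale \<i> v)"
    by (simp only: nrm_scale) simp
qed

text \<open>
  The symmetries \<open>v \<mapsto> - v\<close> and \<open>(u, v) \<mapsto> (v, u)\<close> generate all sign changes of the two
  differences.
\<close>

lemma unit_product_bound:
  assumes uv: "nrm u = 1" "nrm v = 1"
  shows "cmod (Complex ((nrm (u + v))\<^sup>2 - (nrm (u - v))\<^sup>2)
           ((nrm (u + scale \<i> v))\<^sup>2 - (nrm (u - scale \<i> v))\<^sup>2)) \<le> 4"
proof -
  let ?B = "\<lambda>u v. cmod (Complex ((nrm (u + v))\<^sup>2 - (nrm (u - v))\<^sup>2)
           ((nrm (u + scale \<i> v))\<^sup>2 - (nrm (u - scale \<i> v))\<^sup>2))"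
  have neg: "?B u (- v) = ?B u v" for u v
    by (simp add: cmod_def power2_commute)
  have re_nonneg: "?B u v \<le> 4"
    if "nrm u = 1" "nrm v = 1" "nrm (u - v) \<le> nrm (u + v)" for u v
  proof (cases "nrm (u - scale \<i> v) \<le> nrm (u + scale \<i> v)")
    case True
    with that show ?thesis
      by (intro unit_product_bound_nonneg)
  next
    case False
    have sum_eq: "nrm (v + u) = nrm (u + v)"
      by (simp only: add.commute)
    note swap = sum_eq nrm_minus_commute[of v u] nrm_swap_i[of v u]
    have "?B v u \<le> 4"
    proof (rule unit_product_bound_nonneg)
      show "nrm (v - u) \<le> nrm (v + u)" "nrm (v - scale \<i> u) \<le> nrm (v + scale \<i> u)"
        unfolding swap using False that by simp_all
    qed fact+
    then show ?thesis
      unfolding swap by (simp add: cmod_def power2_commute)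
  qed
  show ?thesis
  proof (cases "nrm (u - v) \<le> nrm (u + v)")
    case True
    with uv show ?thesis
      by (rule re_nonneg)
  next
    case False
    then have "?B u (- v) \<le> 4"
      using uv by (intro re_nonneg) (simp_all add: nrm_uminus)
    then show ?thesis
      by (simp only: neg)
  qed
qed

lemma nrm_unit_vec:
  assumes "x \<noteq> 0"
  shows "nrm (unit_vec scale nrm x) = 1"
  using assms nrm_nonneg[of x]
  by (simp add: unit_vec_def nrm_scale nrm_eq_0_iff norm_divide)

end

theorem theorem3p1:
  fixes scale :: "complex \<Rightarrow> 'a::ab_group_add \<Rightarrow> 'a"
    and nrm :: "'a \<Rightarrow> real"
    and x y :: 'a
  assumes "complex_normed_space scale nrm"
  shows "cmod (assoc_product scale nrm x y) \<le> nrm x * nrm y"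
proof -
  interpret complex_normed_space scale nrm
    by (rule assms)
  have xy: "0 \<le> nrm x * nrm y"
    by (simp add: nrm_nonneg)
  show ?thesis
  proof (cases "x = 0 \<or> y = 0")
    case True
    with xy show ?thesis
      by (auto simp: assoc_product_def)
  next
    case False
    define u where "u = unit_vec scale nrm x"
    define v where "v = unit_vec scale nrm y"
    define B where "B = Complex ((nrm (u + v))\<^sup>2 - (nrm (u - v))\<^sup>2)
           ((nrm (u + scale \<i> v))\<^sup>2 - (nrm (u - scale \<i> v))\<^sup>2)"
    have "cmod B \<le> 4"
      using False unfolding B_def u_def v_def
      by (intro unit_product_bound nrm_unit_vec) auto
    have "assoc_product scale nrm x y = of_real (nrm x * nrm y) * (1 / 4) * B"
      using False by (simp add: assoc_product_def Let_def B_def Complex_eq flip: u_def v_def)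
    then have "cmod (assoc_product scale nrm x y) = nrm x * nrm y * (cmod B / 4)"
      by (simp only: norm_mult norm_of_real) (simp add: nrm_nonneg norm_divide)
    also have "\<dots> \<le> nrm x * nrm y"
      using mult_left_mono[OF _ xy, of "cmod B / 4" 1] \<open>cmod B \<le> 4\<close> by simp
    finally show ?thesis .
  qed
qed

end
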